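(* Let $T_0$ be a $b\times a$ brick with $a\le b$ (equivalently, a bipartite graph with colour classes $A$, $|A|=a$, and $B$, $|B|=b$) that is $m$-excessive. Then $T_0$ is $m$-extendable: every matching of size $m$ in $T_0$ can be extended to a maximum matching of size $a$.
   Context: $T_0$ is the grid $B\times A$ of a finite simple bipartite graph $(A,B,E)$ without isolated vertices. An independent set $F\subseteq A\cup B$ is proper if it meets both $A$ and $B$ and contains neither $A$ nor $B$; $\alpha_p(T_0)$ is the maximum size of a proper independent set ($0$ if there is none). The characteristic is $m=b-\alpha_p(T_0)$, and $T_0$ is $m$-excessive if this $m$ is $>0$. $T_0$ is $m$-extendable if every matching of size $m$ can be extended to a matching of size $a$. *)

theory Defs
  imports Main "HOL-Library.Disjoint_Sets"
begin

(* A b x a brick T0 is represented by its bipartite graph: rows are the vertices of B, columns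
   those of A, and a cell (v, u) of the grid B x A belongs to the pattern iff {u, v} is an edge. *)

definition bipartite_graph :: "'v set \<Rightarrow> 'v set \<Rightarrow> 'v set set \<Rightarrow> bool" where
  "bipartite_graph A B E \<longleftrightarrow>
     finite A \<and> finite B \<and> A \<inter> B = {} \<and> E \<subseteq> {{u, v} | u v. u \<in> A \<and> v \<in> B}"

definition no_isolated_vertices :: "'v set \<Rightarrow> 'v set \<Rightarrow> 'v set set \<Rightarrow> bool" where
  "no_isolated_vertices A B E \<longleftrightarrow> (\<forall>x \<in> A \<union> B. \<exists>e \<in> E. x \<in> e)"

definition brick :: "'v set \<Rightarrow> 'v set \<Rightarrow> 'v set set \<Rightarrow> bool" where
  "brick A B E \<longleftrightarrow> bipartite_graph A B E \<and> no_isolated_vertices A B E"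

definition independent_set :: "'v set \<Rightarrow> 'v set \<Rightarrow> 'v set set \<Rightarrow> 'v set \<Rightarrow> bool" where
  "independent_set A B E F \<longleftrightarrow> F \<subseteq> A \<union> B \<and> (\<forall>e \<in> E. \<not> e \<subseteq> F)"

definition proper_independent_set :: "'v set \<Rightarrow> 'v set \<Rightarrow> 'v set set \<Rightarrow> 'v set \<Rightarrow> bool" where
  "proper_independent_set A B E F \<longleftrightarrow>
     independent_set A B E F \<and> F \<inter> A \<noteq> {} \<and> F \<inter> B \<noteq> {} \<and> \<not> A \<subseteq> F \<and> \<not> B \<subseteq> F"

definition alpha_p :: "'v set \<Rightarrow> 'v set \<Rightarrow> 'v set set \<Rightarrow> nat" where
  "alpha_p A B E =
     (if \<exists>F. proper_independent_set A B E F
      then Max {card F | F. proper_independent_set A B E F} else 0)"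

(* Integer-valued: alpha_p may exceed card B. *)
definition characteristic :: "'v set \<Rightarrow> 'v set \<Rightarrow> 'v set set \<Rightarrow> int" where
  "characteristic A B E = int (card B) - int (alpha_p A B E)"

definition excessive :: "nat \<Rightarrow> 'v set \<Rightarrow> 'v set \<Rightarrow> 'v set set \<Rightarrow> bool" where
  "excessive m A B E \<longleftrightarrow> int m = characteristic A B E \<and> m > 0"

definition matching :: "'v set set \<Rightarrow> 'v set set \<Rightarrow> bool" where
  "matching E M \<longleftrightarrow> M \<subseteq> E \<and> disjoint M"

definition maximum_matching :: "'v set set \<Rightarrow> 'v set set \<Rightarrow> bool" where
  "maximum_matching E M \<longleftrightarrow> matching E M \<and> (\<forall>N. matching E N \<longrightarrow> card N \<le> card M)"

definition extendable :: "nat \<Rightarrow> 'v set \<Rightarrow> 'v set set \<Rightarrow> bool" where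
  "extendable m A E \<longleftrightarrow>
     (\<forall>M. matching E M \<and> card M = m \<longrightarrow>
        (\<exists>M'. matching E M' \<and> M \<subseteq> M' \<and> card M' = card A))"

end

(* Hall's condition is checked on the vertices of A missed by the matching M. For such a nonempty
   set X, the set X together with the vertices of B that are not adjacent to X is independent; it
   is proper unless X is adjacent to all of B, and then the characteristic gives |N(X)| >= |X| + m,
   so that deleting the m vertices of B covered by M keeps Hall's condition. If N(X) = B, then
   a <= b suffices. *)

theory Submission imports Defs begin

text \<open>Halmos-Vaughan induction on \<open>A\<close>. Either some nonempty proper subset
  \<open>X\<close> is tight, with exactly \<open>card X\<close> neighbours, and then
  \<open>X\<close> and \<open>A - X\<close> are matched separately; or every such subset has a
  neighbour to spare, and then one vertex may be matched arbitrarily.\<close>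

theorem hall_marriage:
  fixes N :: "'a \<Rightarrow> 'b set"
  assumes "finite A"
    and "\<And>u. u \<in> A \<Longrightarrow> finite (N u)"
    and "\<And>X. X \<subseteq> A \<Longrightarrow> card X \<le> card (\<Union>(N ` X))"
  shows "\<exists>f. inj_on f A \<and> (\<forall>u\<in>A. f u \<in> N u)"
  using assms
proof (induction A arbitrary: N rule: finite_psubset_induct)
  case (psubset A)
  note finN = psubset.prems(1) and hall = psubset.prems(2)
  have fin: "finite (\<Union>(N ` X))" if "X \<subseteq> A" for X
    using that finN psubset.hyps finite_subset by blast
  consider (empty) "A = {}"
    | (tight) X where "X \<noteq> {}" "X \<subset> A" "card (\<Union>(N ` X)) = card X"
    | (surplus) "A \<noteq> {}"
        "\<And>X. X \<noteq> {} \<Longrightarrow> X \<subset> A \<Longrightarrow> card X < card (\<Union>(N ` X))"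
    using hall by (metis order_le_less psubset_imp_subset)
  then show ?case
  proof cases
    case empty
    then show ?thesis by simp
  next
    case tight
    let ?U = "\<Union>(N ` X)"
    have "\<exists>f. inj_on f X \<and> (\<forall>u\<in>X. f u \<in> N u)"
      using tight finN hall by (intro psubset.IH) auto
    then obtain f where f: "inj_on f X" "\<forall>u\<in>X. f u \<in> N u" by blast
    have "\<exists>g. inj_on g (A - X) \<and> (\<forall>u\<in>A - X. g u \<in> N u - ?U)"
    proof (rule psubset.IH)
      show "A - X \<subset> A" using tight by blast
      show "finite (N u - ?U)" if "u \<in> A - X" for u using finN that by blast
      fix Y assume Y: "Y \<subseteq> A - X"
      have XY: "X \<subseteq> A" "X \<union> Y \<subseteq> A" "X \<inter> Y = {}" using Y tight by auto
      have finXY: "finite X" "finite Y"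
        using XY psubset.hyps by (auto intro: finite_subset)
      let ?W = "\<Union>((\<lambda>u. N u - ?U) ` Y)"
      \<comment> \<open>Hall's condition for the reduced sets comes from the condition for
        \<open>X \<union> Y\<close>: as \<open>X\<close> is tight, \<open>card X\<close> cancels
        against \<open>card ?U\<close>.\<close>
      have "card X + card Y = card (X \<union> Y)"
        using finXY XY by (simp add: card_Un_disjoint)
      also have "\<dots> \<le> card (\<Union>(N ` (X \<union> Y)))" using hall XY by blast
      also have "\<Union>(N ` (X \<union> Y)) = ?U \<union> ?W" by auto
      also have "card (?U \<union> ?W) \<le> card ?U + card ?W" by (rule card_Un_le)
      finally show "card Y \<le> card ?W" using tight by simp
    qed
    then obtain g where g: "inj_on g (A - X)" "\<forall>u\<in>A - X. g u \<in> N u - ?U" by blast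
    let ?h = "\<lambda>u. if u \<in> X then f u else g u"
    \<comment> \<open>All values of \<open>f\<close> on \<open>X\<close> lie in \<open>?U\<close>,
      which \<open>g\<close> avoids, so gluing the two maps keeps injectivity.\<close>
    have cross: "g u \<noteq> f v" if "u \<in> A - X" "v \<in> X" for u v
      using f(2) g(2) that by (metis DiffD2 UN_I)
    have "inj_on ?h A"
    proof (rule inj_onI)
      fix u v assume "u \<in> A" "v \<in> A" "?h u = ?h v"
      then show "u = v"
        using f(1) g(1) cross[of u v] cross[of v u]
        by (cases "u \<in> X"; cases "v \<in> X") (auto dest: inj_onD)
    qed
    moreover have "\<forall>u\<in>A. ?h u \<in> N u" using f g by auto
    ultimately show ?thesis by blast
  next
    case surplus
    then obtain a where a: "a \<in> A" by blast
    then have "N a \<noteq> {}" using hall[of "{a}"] by auto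
    then obtain y where y: "y \<in> N a" by blast
    have "\<exists>f. inj_on f (A - {a}) \<and> (\<forall>u\<in>A - {a}. f u \<in> N u - {y})"
    proof (rule psubset.IH)
      show "A - {a} \<subset> A" using a by blast
      show "finite (N u - {y})" if "u \<in> A - {a}" for u using finN that by blast
      fix Y assume Y: "Y \<subseteq> A - {a}"
      show "card Y \<le> card (\<Union>((\<lambda>u. N u - {y}) ` Y))"
      proof (cases "Y = {}")
        case False
        \<comment> \<open>Since \<open>Y\<close> omits \<open>a\<close>, it is a proper subset of
          \<open>A\<close>; the strict inequality pays for the loss of \<open>y\<close>.\<close>
        have "card Y < card (\<Union>(N ` Y))" using False Y a by (intro surplus) auto
        moreover have "card (\<Union>(N ` Y)) - 1 \<le> card (\<Union>(N ` Y) - {y})"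
          by (simp add: card_Diff_singleton_if)
        moreover have "(\<Union>u\<in>Y. N u - {y}) = \<Union>(N ` Y) - {y}" by auto
        ultimately show ?thesis by simp
      qed simp
    qed
    then obtain f where f: "inj_on f (A - {a})" "\<forall>u\<in>A - {a}. f u \<in> N u - {y}" by blast
    have "inj_on (f(a := y)) A"
    proof (rule inj_onI)
      fix u v assume "u \<in> A" "v \<in> A" "(f(a := y)) u = (f(a := y)) v"
      then show "u = v"
        using f by (cases "u = a"; cases "v = a") (auto dest: inj_onD)
    qed
    moreover have "\<forall>u\<in>A. (f(a := y)) u \<in> N u" using f y by auto
    ultimately show ?thesis by blast
  qed
qed

lemma bipartite_edge_cases:
  assumes "bipartite_graph A B E" "e \<in> E"
  obtains u v where "e = {u, v}" "u \<in> A" "v \<in> B" "A \<inter> e = {u}" "B \<inter> e = {v}"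
proof -
  from assms have "e \<in> {{u, v} | u v. u \<in> A \<and> v \<in> B}" "A \<inter> B = {}"
    unfolding bipartite_graph_def by blast+
  then show thesis using that by blast
qed

text \<open>Makes facts proved for the colour class \<open>A\<close> available for
  \<open>B\<close>.\<close>

lemma bipartite_graph_swap: "bipartite_graph A B E \<Longrightarrow> bipartite_graph B A E"
proof -
  have "{{u, v} | u v. u \<in> A \<and> v \<in> B} = {{u, v} | u v. u \<in> B \<and> v \<in> A}"
    by (metis insert_commute)
  then show "bipartite_graph A B E \<Longrightarrow> bipartite_graph B A E"
    by (simp add: bipartite_graph_def Int_commute)
qed

text \<open>An edge meets \<open>A\<close> in exactly one vertex, and disjoint edges meet it in
  different ones, so sending an edge to its end in \<open>A\<close> is a bijection.\<close>

lemma card_matching_eq_card_covered: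
  assumes bip: "bipartite_graph A B E" and M: "matching E M"
  shows "card (A \<inter> \<Union>M) = card M"
proof -
  have sub: "M \<subseteq> E" and dis: "disjoint M" using M by (auto simp: matching_def)
  have single: "\<exists>u. A \<inter> e = {u}" if "e \<in> M" for e
    using bipartite_edge_cases[OF bip] sub that by (metis subsetD)
  have "bij_betw (\<lambda>e. the_elem (A \<inter> e)) M (A \<inter> \<Union>M)"
  proof (rule bij_betw_imageI)
    show "inj_on (\<lambda>e. the_elem (A \<inter> e)) M"
    proof (rule inj_onI)
      fix e e' assume e: "e \<in> M" "e' \<in> M" "the_elem (A \<inter> e) = the_elem (A \<inter> e')"
      obtain u where u: "A \<inter> e = {u}" using single e by blast
      obtain u' where u': "A \<inter> e' = {u'}" using single e by blast
      have "u \<in> e \<inter> e'" using e u u' by auto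
      then show "e = e'" using dis e by (auto dest: disjointD)
    qed
    show "(\<lambda>e. the_elem (A \<inter> e)) ` M = A \<inter> \<Union>M"
    proof (intro equalityI subsetI)
      fix x assume "x \<in> (\<lambda>e. the_elem (A \<inter> e)) ` M"
      then obtain e where e: "e \<in> M" "x = the_elem (A \<inter> e)" by blast
      obtain u where "A \<inter> e = {u}" using single e by blast
      then show "x \<in> A \<inter> \<Union>M" using e by auto
    next
      fix x assume "x \<in> A \<inter> \<Union>M"
      then obtain e where e: "e \<in> M" "x \<in> A \<inter> e" by blast
      obtain u where "A \<inter> e = {u}" using single e by blast
      then have "x = the_elem (A \<inter> e)" using e by auto
      then show "x \<in> (\<lambda>e. the_elem (A \<inter> e)) ` M" using e by blast
    qed
  qed
  then show ?thesis by (simp add: bij_betw_same_card)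
qed

lemma card_proper_independent_set_le_alpha_p:
  assumes "finite A" "finite B" and F: "proper_independent_set A B E F"
  shows "card F \<le> alpha_p A B E"
proof -
  have "{F. proper_independent_set A B E F} \<subseteq> Pow (A \<union> B)"
    by (auto simp: proper_independent_set_def independent_set_def)
  then have "finite {F. proper_independent_set A B E F}"
    using assms finite_subset by blast
  then have "finite {card F | F. proper_independent_set A B E F}" by simp
  then show ?thesis using F by (auto simp: alpha_p_def intro: Max_ge)
qed

text \<open>The class \<open>B\<close> is a parameter so that it can be replaced by the part of
  \<open>B\<close> that a matching leaves uncovered.\<close>

definition neighbours :: "'v set \<Rightarrow> 'v set set \<Rightarrow> 'v \<Rightarrow> 'v set" where
  "neighbours B E u = {v \<in> B. {u, v} \<in> E}"

text \<open>The independent set \<open>?F\<close> has size \<open>card X + card B - card ?U\<close>,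
  which is at most \<open>alpha_p A B E\<close> once \<open>?F\<close> is proper. It meets
  \<open>A\<close> since \<open>X\<close> is nonempty, misses part of \<open>A\<close> since
  \<open>X\<close> is not all of \<open>A\<close>, and meets \<open>B\<close> by
  \<open>nB\<close>.\<close>

lemma card_neighbours_ge:
  assumes brick: "brick A B E" and X: "X \<noteq> {}" "X \<subset> A"
    and nB: "\<Union>(neighbours B E ` X) \<noteq> B"
  shows "int (card X) + characteristic A B E \<le> int (card (\<Union>(neighbours B E ` X)))"
proof -
  let ?U = "\<Union>(neighbours B E ` X)"
  let ?F = "X \<union> (B - ?U)"
  have bip: "bipartite_graph A B E" and noiso: "no_isolated_vertices A B E"
    using brick by (auto simp: brick_def)
  have fin: "finite A" "finite B" and AB: "A \<inter> B = {}"
    using bip by (auto simp: bipartite_graph_def)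
  have UB: "?U \<subseteq> B" by (auto simp: neighbours_def)
  \<comment> \<open>Here the absence of isolated vertices enters: with no neighbours of
    \<open>X\<close>, the set \<open>?F\<close> would contain \<open>B\<close> and not be
    proper.\<close>
  have "?U \<noteq> {}"
  proof -
    obtain u where u: "u \<in> X" using X by blast
    then obtain e where e: "e \<in> E" "u \<in> e"
      using noiso X unfolding no_isolated_vertices_def by blast
    obtain u' v where "e = {u', v}" "v \<in> B" "A \<inter> e = {u'}"
      using bipartite_edge_cases[OF bip e(1)] by metis
    moreover have "u \<in> A" using u X by blast
    ultimately have "v \<in> neighbours B E u" using e by (auto simp: neighbours_def)
    then show ?thesis using u by blast
  qed
  have "\<not> e \<subseteq> ?F" if e: "e \<in> E" for e
  proof
    assume "e \<subseteq> ?F"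
    moreover obtain u v where "e = {u, v}" "u \<in> A" "v \<in> B"
      using bipartite_edge_cases[OF bip e] by metis
    ultimately show False using AB X e by (auto simp: neighbours_def)
  qed
  moreover have "?F \<subseteq> A \<union> B" "?F \<inter> A \<noteq> {}" "?F \<inter> B \<noteq> {}"
    using X UB nB by auto
  moreover have "\<not> A \<subseteq> ?F" "\<not> B \<subseteq> ?F" using X AB UB \<open>?U \<noteq> {}\<close> by blast+
  ultimately have "proper_independent_set A B E ?F"
    by (simp add: proper_independent_set_def independent_set_def)
  then have "card ?F \<le> alpha_p A B E"
    using fin by (rule_tac card_proper_independent_set_le_alpha_p)
  moreover have "card ?F = card X + card (B - ?U)"
    using X AB fin by (intro card_Un_disjoint) (auto intro: finite_subset)
  moreover have "card B = card ?U + card (B - ?U)"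
    using UB fin by (metis card_Diff_subset card_mono finite_subset le_add_diff_inverse)
  ultimately show ?thesis by (simp add: characteristic_def)
qed

text \<open>The conclusion asks for a cover of \<open>A\<close> rather than for a size: the cover is
  immediate from the construction, and counting covered vertices turns it into size
  \<open>card A\<close>.\<close>

lemma excessive_matching_extends:
  assumes brick: "brick A B E" and ab: "card A \<le> card B" and exc: "excessive m A B E"
    and M: "matching E M" "card M = m"
  shows "\<exists>M'. matching E M' \<and> M \<subseteq> M' \<and> A \<subseteq> \<Union>M'"
proof -
  let ?A = "A - \<Union>M" and ?B = "B - \<Union>M"
  have bip: "bipartite_graph A B E" using brick by (simp add: brick_def)
  have fin: "finite A" "finite B" and AB: "A \<inter> B = {}"
    using bip by (auto simp: bipartite_graph_def)
  have cA: "card (A \<inter> \<Union>M) = m" and cB: "card (B \<inter> \<Union>M) = m"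
    using card_matching_eq_card_covered bip bipartite_graph_swap M by blast+
  have char: "characteristic A B E = int m" and "m > 0"
    using exc by (auto simp: excessive_def)
  \<comment> \<open>Because \<open>m > 0\<close>, some vertex of \<open>A\<close> is covered, so
    every subset of \<open>?A\<close> is a proper subset of \<open>A\<close>, as the bound on
    neighbours requires.\<close>
  have subA: "?A \<subset> A" using cA \<open>m > 0\<close> by (cases "A \<inter> \<Union>M = {}") auto
  have "\<exists>f. inj_on f ?A \<and> (\<forall>u\<in>?A. f u \<in> neighbours ?B E u)"
  proof (rule hall_marriage)
    fix X assume X: "X \<subseteq> ?A"
    let ?U = "\<Union>(neighbours B E ` X)"
    have eq: "\<Union>(neighbours ?B E ` X) = ?U - (B \<inter> \<Union>M)" by (auto simp: neighbours_def)
    consider "X = {}" | "?U = B" | "X \<noteq> {}" "?U \<noteq> B" by blast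
    then show "card X \<le> card (\<Union>(neighbours ?B E ` X))"
    proof cases
      case 2
      \<comment> \<open>All of \<open>?B\<close> is adjacent to \<open>X\<close>, and
        \<open>M\<close> covers \<open>m\<close> vertices in each class, so the comparison of
        \<open>A\<close> with \<open>B\<close> survives the deletion.\<close>
      have "card X \<le> card ?A" using X fin by (intro card_mono) auto
      also have "\<dots> = card A - m" using fin cA by (simp add: card_Diff_subset_Int)
      also have "\<dots> \<le> card B - m" using ab by simp
      also have "\<dots> = card (B - (B \<inter> \<Union>M))" using fin cB by (simp add: card_Diff_subset_Int)
      finally show ?thesis using 2 eq by simp
    next
      case 3
      have "int (card X) + characteristic A B E \<le> int (card ?U)"
        using X subA 3 by (intro card_neighbours_ge[OF brick]) auto
      \<comment> \<open>The surplus given by the characteristic is exactly the number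
        \<open>m\<close> of deleted vertices.\<close>
      then have "card X \<le> card ?U - card (B \<inter> \<Union>M)" using char cB by simp
      also have "\<dots> \<le> card (?U - (B \<inter> \<Union>M))" using fin by (intro diff_card_le_card_Diff) simp
      finally show ?thesis using eq by simp
    qed simp
  qed (use fin in \<open>auto simp: neighbours_def\<close>)
  then obtain f where f: "inj_on f ?A" "\<And>u. u \<in> ?A \<Longrightarrow> f u \<in> ?B \<and> {u, f u} \<in> E"
    by (auto simp: neighbours_def)
  let ?N = "(\<lambda>u. {u, f u}) ` ?A"
  have "disjoint (M \<union> ?N)"
  proof (rule disjoint_union)
    show "disjoint M" using M by (simp add: matching_def)
    show "disjoint ?N"
    proof (rule disjointI)
      fix e e' assume "e \<in> ?N" "e' \<in> ?N" "e \<noteq> e'"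
      then obtain u u' where u: "e = {u, f u}" "e' = {u', f u'}" "u \<in> ?A" "u' \<in> ?A" "u \<noteq> u'"
        by blast
      then have "f u \<noteq> f u'" using f by (auto dest: inj_onD)
      moreover have "f u \<in> B" "f u' \<in> B" using u f by auto
      ultimately show "e \<inter> e' = {}" using u AB by auto
    qed
    \<comment> \<open>Both ends of each new edge were chosen outside
      \<open>\<Union>M\<close>.\<close>
    show "\<Union>M \<inter> \<Union>?N = {}" using f by auto
  qed
  then have "matching E (M \<union> ?N)" using M f by (auto simp: matching_def)
  moreover have "A \<subseteq> \<Union>(M \<union> ?N)" by blast
  ultimately show ?thesis by blast
qed

theorem proposition5p37:
  fixes A B :: "'v set" and E :: "'v set set" and m :: nat
  assumes "brick A B E"
    and "card A \<le> card B"
    and "excessive m A B E"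
  shows "extendable m A E \<and>
         (\<forall>M. matching E M \<and> card M = m \<longrightarrow>
            (\<exists>M'. maximum_matching E M' \<and> M \<subseteq> M' \<and> card M' = card A))"
proof -
  have bip: "bipartite_graph A B E" and fin: "finite A"
    using assms(1) by (auto simp: brick_def bipartite_graph_def)
  \<comment> \<open>A matching has as many edges as it covers vertices of \<open>A\<close>; hence
    one of size \<open>card A\<close> is maximum.\<close>
  have le: "card N \<le> card A" if "matching E N" for N
    using card_matching_eq_card_covered[OF bip that] fin
    by (metis card_mono inf_le1)
  have "\<exists>M'. maximum_matching E M' \<and> M \<subseteq> M' \<and> card M' = card A"
    if M: "matching E M" "card M = m" for M
  proof -
    obtain M' where M': "matching E M'" "M \<subseteq> M'" "A \<subseteq> \<Union>M'"
      using excessive_matching_extends[OF assms M] by blast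
    have "card M' = card A"
      using card_matching_eq_card_covered[OF bip M'(1)] M'(3) by (simp add: Int_absorb2)
    then show ?thesis using M' le by (auto simp: maximum_matching_def)
  qed
  then show ?thesis unfolding extendable_def maximum_matching_def by blast
qed

end
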